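(* If $\mathfrak{b}=\mathfrak{d}$ then $\Delta(\mathcal{M})$ holds; if $\mathfrak{d}=\mathfrak{c}$ then $\Delta(\mathcal{M}(\mathfrak{c}))$ holds; and if the Model Hypothesis $\mathsf{MH}$ holds then $\Delta(\mathcal{SM})$ holds.
   Context: $\mathfrak{b}$ and $\mathfrak{d}$ are the minimal sizes of an unbounded, respectively dominating, family in $\omega^\omega$ under the mod-finite order $\le^*$; $\mathfrak{c}=2^{\aleph_0}$. $H(\omega_1)$ is the collection of sets whose transitive closure has size less than $\omega_1$. $\mathsf{MH}$ is the statement: for some $\kappa$, $H(\omega_1)$ is the increasing union of $H_\alpha$'s, $\alpha<\kappa$, where each $H_\alpha$ is an elementary submodel of $(H(\omega_1),\in)$ and each $H_\alpha\cap\omega^\omega$ is not dominating. $\mathcal{M}$ is the class of all metrizable spaces, $\mathcal{M}(\mathfrak{c})$ the class of metrizable spaces of cardinality $\le\mathfrak{c}$, and $\mathcal{SM}$ the class of separable metrizable spaces. For spaces $X_n$ ($n\in\omega$), $\square_nX_n$ is $\prod_nX_n$ with base all $\prod_nU_n$, $U_n$ open in $X_n$; $x\sim y$ iff $\{n:x(n)\neq y(n)\}$ is finite; $\nabla_nX_n=\square_nX_n/\sim$. Elements of $\nabla_nX_n$ are denoted by representatives. For metrics $d_n$ on $X_n$: $B_n(a,\varepsilon)$ is $\{a\}$ if $a$ is isolated in $X_n$, and otherwise the $\varepsilon$-ball about $a$ in $d_n$. For $x,y\in\nabla_nX_n$, $f\in\omega^\omega$, $M(x,f;y)=\{n: y(n)\notin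 B_n(x(n),1/f(n))\}$, with the convention $1/0=\infty$. $(x,f),(y,g)\in\nabla_nX_n\times\omega^\omega$ switch if $M(x,f;y)$ and $M(y,g;x)$ are infinite with finite intersection. $\Delta((X_n,d_n)_n)$ is the statement: there is $F:\nabla_nX_n\times\omega^\omega\to\omega^\omega$, writing $f_x:=F(x,f)$, such that if $(x,f),(y,g)$ switch, then $1/f_x(n)+1/g_y(n)<d_n(x(n),y(n))$ for infinitely many $n$. For metrizable spaces $X_n$, $\Delta((X_n)_n)$ means that $\Delta((X_n,d_n)_n)$ holds for some choice of compatible metrics $d_n$. For a class $\mathcal{C}$ of metrizable spaces, $\Delta(\mathcal{C})$ means that $\Delta((X_n)_n)$ holds for every sequence $(X_n)_{n\in\omega}$ of spaces from $\mathcal{C}$. *)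

theory Defs
  imports "HOL-Analysis.Analysis" "HOL-Library.Countable_Set_Type"
begin

unbundle cardinal_syntax

section \<open>Cardinal characteristics\<close>

definition le_star :: "(nat \<Rightarrow> nat) \<Rightarrow> (nat \<Rightarrow> nat) \<Rightarrow> bool"  (infix \<open>\<le>*\<close> 50)
  where "f \<le>* g \<longleftrightarrow> finite {n. \<not> f n \<le> g n}"

definition unbounded_family :: "(nat \<Rightarrow> nat) set \<Rightarrow> bool"
  where "unbounded_family B \<longleftrightarrow> \<not> (\<exists>g. \<forall>f\<in>B. f \<le>* g)"

definition dominating_family :: "(nat \<Rightarrow> nat) set \<Rightarrow> bool"
  where "dominating_family D \<longleftrightarrow> (\<forall>g. \<exists>f\<in>D. g \<le>* f)"

text \<open>Cardinals are represented by well-orders and compared up to order isomorphism (\<open>=o\<close>,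
  \<open>\<le>o\<close>).  The lemmas \<open>min_card_attained\<close> and \<open>min_card_le\<close> show that the choice below is sound.\<close>

definition min_card :: "('a set \<Rightarrow> bool) \<Rightarrow> 'a rel"
  where "min_card P = |SOME A. P A \<and> (\<forall>B. P B \<longrightarrow> |A| \<le>o |B| )|"

lemma min_card_exists:
  assumes "P C"
  shows "\<exists>A. P A \<and> (\<forall>B. P B \<longrightarrow> |A| \<le>o |B| )"
proof -
  have "wf (inv_image ordLess (\<lambda>A :: 'a set. |A| ))"
    by (intro wf_inv_image wf_ordLess)
  then obtain A where A: "A \<in> Collect P"
    and min: "\<And>B. (B, A) \<in> inv_image ordLess (\<lambda>A :: 'a set. |A| ) \<Longrightarrow> B \<notin> Collect P"
    using assms by (elim wfE_min[where Q = "Collect P" and x = C]) auto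
  have "|A| \<le>o |B|" if "P B" for B
  proof -
    have "\<not> |B| <o |A|" using min[of B] that by (auto simp: inv_image_def)
    then show ?thesis
      by (simp add: not_ordLess_iff_ordLeq card_of_Well_order)
  qed
  then show ?thesis using A by auto
qed

lemma min_card_attained:
  assumes "P C"
  shows "\<exists>A. P A \<and> min_card P = |A|"
proof -
  let ?A = "SOME A. P A \<and> (\<forall>B. P B \<longrightarrow> |A| \<le>o |B| )"
  have "P ?A \<and> (\<forall>B. P B \<longrightarrow> |?A| \<le>o |B| )"
    using assms by (rule someI_ex[OF min_card_exists])
  then show ?thesis unfolding min_card_def by (intro exI[of _ ?A]) simp
qed

lemma min_card_le:
  assumes "P B"
  shows "min_card P \<le>o |B|"
proof -
  let ?A = "SOME A. P A \<and> (\<forall>B. P B \<longrightarrow> |A| \<le>o |B| )"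
  have "P ?A \<and> (\<forall>B. P B \<longrightarrow> |?A| \<le>o |B| )"
    using assms by (rule someI_ex[OF min_card_exists])
  then show ?thesis unfolding min_card_def using assms by simp
qed

definition bounding_number :: "(nat \<Rightarrow> nat) rel"  (\<open>\<bb>\<close>)
  where "\<bb> = min_card unbounded_family"

definition dominating_number :: "(nat \<Rightarrow> nat) rel"  (\<open>\<dd>\<close>)
  where "\<dd> = min_card dominating_family"

definition continuum :: "nat set rel"  (\<open>\<cc>\<close>)
  where "\<cc> = |Pow (UNIV :: nat set)|"

lemma dominating_family_UNIV: "dominating_family UNIV"
proof -
  have "g \<le>* g" for g by (simp add: le_star_def)
  then show ?thesis unfolding dominating_family_def by blast
qed

lemma unbounded_family_UNIV: "unbounded_family UNIV"
proof -
  have "\<not> (\<lambda>n. Suc (g n)) \<le>* g" for g by (simp add: le_star_def)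
  then show ?thesis unfolding unbounded_family_def by blast
qed


section \<open>Hereditarily countable sets\<close>

text \<open>The initial algebra of the countable powerset functor: well-founded, extensional
  (\<open>elems_inject\<close>), closed under countable subsets (\<open>elems_hset\<close>), and every element has countable
  transitive closure (\<open>countable_trans_closure\<close>).  This is $H(\omega_1)$.\<close>

datatype hc = HC (members: "hc cset")

definition elems :: "hc \<Rightarrow> hc set"
  where "elems x = rcset (members x)"

definition hset :: "hc set \<Rightarrow> hc"
  where "hset A = HC (acset A)"

lemma elems_inject: "elems x = elems y \<longleftrightarrow> x = y"
  by (cases x; cases y) (simp add: elems_def rcset_inject)

lemma elems_hset: "countable A \<Longrightarrow> elems (hset A) = A"
  by (simp add: elems_def hset_def)

lemma countable_elems: "countable (elems x)"
  using rcset[of "members x"] by (simp add: elems_def)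

lemma hc_elems_induct:
  assumes "\<And>x. (\<And>y. y \<in> elems x \<Longrightarrow> P y) \<Longrightarrow> P x"
  shows "P x"
proof (induction x)
  case (HC A)
  show ?case
  proof (rule assms)
    fix y assume "y \<in> elems (HC A)"
    then have "y \<in> rcset A" by (simp add: elems_def)
    then show "P y" by (rule HC)
  qed
qed

lemma wf_elems: "wf {(y, x). y \<in> elems x}"
proof (rule wfUNIVI)
  fix P :: "hc \<Rightarrow> bool" and x
  assume "\<forall>x. (\<forall>y. (y, x) \<in> {(y, x). y \<in> elems x} \<longrightarrow> P y) \<longrightarrow> P x"
  then show "P x" using hc_elems_induct[of P x] by simp
qed

lemma countable_trans_closure: "countable {y. (y, x) \<in> {(u, v). u \<in> elems v}\<^sup>+}"
proof (induction x rule: hc_elems_induct)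
  case (1 x)
  let ?r = "{(u, v). u \<in> elems v}"
  have "{y. (y, x) \<in> ?r\<^sup>+} \<subseteq> elems x \<union> (\<Union>z\<in>elems x. {y. (y, z) \<in> ?r\<^sup>+})"
  proof
    fix y assume "y \<in> {y. (y, x) \<in> ?r\<^sup>+}"
    then have "(y, x) \<in> ?r\<^sup>+" by simp
    then show "y \<in> elems x \<union> (\<Union>z\<in>elems x. {y. (y, z) \<in> ?r\<^sup>+})"
      by (cases rule: tranclE) blast+
  qed
  moreover have "countable \<dots>"
    using 1 by (simp add: countable_elems)
  ultimately show ?case by (rule countable_subset)
qed

text \<open>Elements of $\omega^\omega$ as sets: von Neumann naturals and Kuratowski pairs.\<close>

primrec hc_nat :: "nat \<Rightarrow> hc"
  where
    "hc_nat 0 = hset {}"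
  | "hc_nat (Suc n) = hset (insert (hc_nat n) (elems (hc_nat n)))"

definition hc_pair :: "hc \<Rightarrow> hc \<Rightarrow> hc"
  where "hc_pair x y = hset {hset {x}, hset {x, y}}"

definition hc_fun :: "(nat \<Rightarrow> nat) \<Rightarrow> hc"
  where "hc_fun f = hset (range (\<lambda>n. hc_pair (hc_nat n) (hc_nat (f n))))"


section \<open>Elementary submodels and the Model Hypothesis\<close>

datatype fm = Mem nat nat | Equal nat nat | Neg fm | Conj fm fm | Exists nat fm

primrec sat :: "hc set \<Rightarrow> (nat \<Rightarrow> hc) \<Rightarrow> fm \<Rightarrow> bool"
  where
    "sat A s (Mem i j) \<longleftrightarrow> s i \<in> elems (s j)"
  | "sat A s (Equal i j) \<longleftrightarrow> s i = s j"
  | "sat A s (Neg p) \<longleftrightarrow> \<not> sat A s p"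
  | "sat A s (Conj p q) \<longleftrightarrow> sat A s p \<and> sat A s q"
  | "sat A s (Exists i p) \<longleftrightarrow> (\<exists>a\<in>A. sat A (s(i := a)) p)"

definition elementary_submodel :: "hc set \<Rightarrow> bool"
  where "elementary_submodel A \<longleftrightarrow>
    A \<noteq> {} \<and> (\<forall>p s. range s \<subseteq> A \<longrightarrow> (sat A s p \<longleftrightarrow> sat UNIV s p))"

definition model_chain :: "'k rel \<Rightarrow> ('k \<Rightarrow> hc set) \<Rightarrow> bool"
  where "model_chain \<kappa> H \<longleftrightarrow>
    Well_order \<kappa> \<and>
    (\<forall>(\<alpha>, \<beta>)\<in>\<kappa>. H \<alpha> \<subseteq> H \<beta>) \<and>
    (\<Union>\<alpha>\<in>Field \<kappa>. H \<alpha>) = UNIV \<and>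
    (\<forall>\<alpha>\<in>Field \<kappa>. elementary_submodel (H \<alpha>) \<and> \<not> dominating_family {f. hc_fun f \<in> H \<alpha>})"

text \<open>Ordinals $\kappa$ are well-orders.  The type of the index set has to be fixed in the definition;
  \<open>Model_HypothesisI\<close> shows that nothing is lost: a chain indexed by a well-order on any type
  yields one over the chosen type.\<close>

definition Model_Hypothesis :: bool
  where "Model_Hypothesis \<longleftrightarrow> (\<exists>(\<kappa> :: hc set rel) H. model_chain \<kappa> H)"

lemma Model_HypothesisI:
  fixes r :: "'k rel"
  assumes "model_chain r H"
  shows "Model_Hypothesis"
proof -
  define R where "R = {(A, B). A \<in> H ` Field r \<and> B \<in> H ` Field r \<and> A \<subseteq> B}"
  have wo: "Well_order r" and mono: "\<And>a b. (a, b) \<in> r \<Longrightarrow> H a \<subseteq> H b"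
    and un: "(\<Union>a\<in>Field r. H a) = UNIV"
    and el: "\<And>a. a \<in> Field r \<Longrightarrow>
      elementary_submodel (H a) \<and> \<not> dominating_family {f. hc_fun f \<in> H a}"
    using assms by (auto simp: model_chain_def)
  have fld: "Field R = H ` Field r"
    by (auto simp: R_def Field_def)
  have tot: "H a \<subseteq> H b \<or> H b \<subseteq> H a" if "a \<in> Field r" "b \<in> Field r" for a b
  proof (cases "a = b")
    case False
    then have "(a, b) \<in> r \<or> (b, a) \<in> r"
      using wo that by (auto simp: well_order_on_def linear_order_on_def total_on_def)
    then show ?thesis using mono by blast
  qed simp
  have lin: "Linear_order R"
    unfolding linear_order_on_def partial_order_on_def preorder_on_def fld
    using tot by (auto simp: R_def refl_on_def trans_def antisym_def total_on_def)
  have "wf (R - Id)"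
  proof (rule wfI_min)
    fix x Q assume xQ: "(x :: hc set) \<in> Q"
    show "\<exists>z\<in>Q. \<forall>y. (y, z) \<in> R - Id \<longrightarrow> y \<notin> Q"
    proof (cases "x \<in> H ` Field r")
      case False
      then show ?thesis using xQ by (auto simp: R_def)
    next
      case True
      have "wf (r - Id)" using wo by (simp add: well_order_on_def)
      moreover from True xQ obtain a where a: "a \<in> {a \<in> Field r. H a \<in> Q}" by blast
      ultimately obtain z where zQ: "z \<in> {a \<in> Field r. H a \<in> Q}"
        and zmin: "\<And>y. (y, z) \<in> r - Id \<Longrightarrow> y \<notin> {a \<in> Field r. H a \<in> Q}"
        by (rule wfE_min[where Q = "{a \<in> Field r. H a \<in> Q}"]) blast
      from zQ have z: "z \<in> Field r" "H z \<in> Q" by auto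
      have "y \<notin> Q" if yz: "(y, H z) \<in> R - Id" for y
      proof
        assume "y \<in> Q"
        obtain b where b: "b \<in> Field r" "y = H b" using yz by (auto simp: R_def)
        have sub: "H b \<subset> H z" using yz b by (auto simp: R_def)
        then have "b \<noteq> z" by auto
        then have "(b, z) \<in> r \<or> (z, b) \<in> r"
          using wo b z by (auto simp: well_order_on_def linear_order_on_def total_on_def)
        with sub mono have "(b, z) \<in> r" by blast
        with \<open>b \<noteq> z\<close> zmin[of b] b \<open>y \<in> Q\<close> show False by auto
      qed
      then show ?thesis using z by blast
    qed
  qed
  with lin have "Well_order R" by (simp add: well_order_on_def)
  moreover have "(\<Union>A\<in>Field R. A) = UNIV" using un fld by auto
  ultimately have "model_chain R (\<lambda>A. A)"
    using el unfolding model_chain_def fld by (auto simp: R_def)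
  then show ?thesis unfolding Model_Hypothesis_def by blast
qed


section \<open>Nabla products and the principle \<open>\<Delta>\<close>\<close>

text \<open>Only the underlying set of $\nabla_n X_n$ enters \<open>\<Delta>\<close>, so no topology is put on it.\<close>

definition sim :: "(nat \<Rightarrow> 'a topology) \<Rightarrow> ((nat \<Rightarrow> 'a) \<times> (nat \<Rightarrow> 'a)) set"
  where "sim X = {(x, y). x \<in> (\<Pi> n\<in>UNIV. topspace (X n)) \<and> y \<in> (\<Pi> n\<in>UNIV. topspace (X n)) \<and>
    finite {n. x n \<noteq> y n}}"

definition nabla :: "(nat \<Rightarrow> 'a topology) \<Rightarrow> (nat \<Rightarrow> 'a) set set"
  where "nabla X = (\<Pi> n\<in>UNIV. topspace (X n)) // sim X"

lemma equiv_sim: "equiv (\<Pi> n\<in>UNIV. topspace (X n)) (sim X)"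
proof (rule equivI)
  show "trans (sim X)"
  proof (rule transI)
    fix x y z assume xy: "(x, y) \<in> sim X" and yz: "(y, z) \<in> sim X"
    have "finite ({n. x n \<noteq> y n} \<union> {n. y n \<noteq> z n})"
      using xy yz by (simp add: sim_def)
    then have "finite {n. x n \<noteq> z n}"
      by (rule rev_finite_subset) auto
    with xy yz show "(x, z) \<in> sim X" by (simp add: sim_def)
  qed
qed (auto simp: sim_def refl_on_def sym_def eq_commute)

definition recip :: "nat \<Rightarrow> ereal"
  where "recip k = (if k = 0 then \<infinity> else ereal (1 / real k))"

definition isolated_point :: "'a topology \<Rightarrow> 'a \<Rightarrow> bool"
  where "isolated_point X a \<longleftrightarrow> openin X {a}"

definition Bball :: "'a topology \<Rightarrow> ('a \<Rightarrow> 'a \<Rightarrow> real) \<Rightarrow> 'a \<Rightarrow> ereal \<Rightarrow> 'a set"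
  where "Bball X d a \<epsilon> =
    (if isolated_point X a then {a} else {y \<in> topspace X. ereal (d a y) < \<epsilon>})"

definition Mset :: "(nat \<Rightarrow> 'a topology) \<Rightarrow> (nat \<Rightarrow> 'a \<Rightarrow> 'a \<Rightarrow> real) \<Rightarrow>
    (nat \<Rightarrow> 'a) \<Rightarrow> (nat \<Rightarrow> nat) \<Rightarrow> (nat \<Rightarrow> 'a) \<Rightarrow> nat set"
  where "Mset X d x f y = {n. y n \<notin> Bball (X n) (d n) (x n) (recip (f n))}"

text \<open>For \<open>x\<close>, \<open>y\<close> representing points of $\nabla_n X_n$; changing representatives alters \<open>Mset\<close> only
  by a finite set, so \<open>switch\<close> does not depend on them.\<close>

definition switch :: "(nat \<Rightarrow> 'a topology) \<Rightarrow> (nat \<Rightarrow> 'a \<Rightarrow> 'a \<Rightarrow> real) \<Rightarrow>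
    (nat \<Rightarrow> 'a) \<times> (nat \<Rightarrow> nat) \<Rightarrow> (nat \<Rightarrow> 'a) \<times> (nat \<Rightarrow> nat) \<Rightarrow> bool"
  where "switch X d = (\<lambda>(x, f) (y, g).
    infinite (Mset X d x f y) \<and> infinite (Mset X d y g x) \<and>
    finite (Mset X d x f y \<inter> Mset X d y g x))"

text \<open>\<open>F\<close> takes points of $\nabla_n X_n$, i.e. equivalence classes \<open>p\<close>, \<open>q\<close>; the remaining clauses are
  evaluated at arbitrary representatives \<open>x \<in> p\<close>, \<open>y \<in> q\<close>.\<close>

definition Delta_metric :: "(nat \<Rightarrow> 'a topology) \<Rightarrow> (nat \<Rightarrow> 'a \<Rightarrow> 'a \<Rightarrow> real) \<Rightarrow> bool"
  where "Delta_metric X d \<longleftrightarrow>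
    (\<exists>F :: (nat \<Rightarrow> 'a) set \<times> (nat \<Rightarrow> nat) \<Rightarrow> (nat \<Rightarrow> nat).
      \<forall>p\<in>nabla X. \<forall>q\<in>nabla X. \<forall>x\<in>p. \<forall>y\<in>q. \<forall>f g.
        switch X d (x, f) (y, g) \<longrightarrow>
          infinite {n. recip (F (p, f) n) + recip (F (q, g) n) < ereal (d n (x n) (y n))})"

definition compatible_metric :: "'a topology \<Rightarrow> ('a \<Rightarrow> 'a \<Rightarrow> real) \<Rightarrow> bool"
  where "compatible_metric X d \<longleftrightarrow>
    Metric_space (topspace X) d \<and> Metric_space.mtopology (topspace X) d = X"

definition Delta_spaces :: "(nat \<Rightarrow> 'a topology) \<Rightarrow> bool"
  where "Delta_spaces X \<longleftrightarrow> (\<exists>d. (\<forall>n. compatible_metric (X n) (d n)) \<and> Delta_metric X d)"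

definition Delta_class :: "'a topology set \<Rightarrow> bool"
  where "Delta_class C \<longleftrightarrow> (\<forall>X :: nat \<Rightarrow> 'a topology. (\<forall>n. X n \<in> C) \<longrightarrow> Delta_spaces X)"

definition metrizable_class :: "'a topology set"
  where "metrizable_class = {X. metrizable_space X}"

definition metrizable_class_card_le :: "'c rel \<Rightarrow> 'a topology set"
  where "metrizable_class_card_le \<kappa> = {X. metrizable_space X \<and> |topspace X| \<le>o \<kappa>}"

definition separable_metrizable_class :: "'a topology set"
  where "separable_metrizable_class = {X. metrizable_space X \<and> separable_space X}"

end

theory Submission
  imports Defs
begin

text \<open>A pair \<open>(x, f)\<close> gives a positive function \<open>f'\<close> with \<open>d (x n) (y n) \<ge> 1 / f' n\<close> for all
  \<open>n\<close> in \<open>M(x, f; y)\<close>, and a switching pair is resolved as soon as one of the two functions \<open>f_x\<close>,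
  \<open>g_y\<close> copes with the gap witnessed by the other side: \<open>f_x\<close> always majorizes a multiple of \<open>f'\<close>,
  so it suffices that \<open>g_y\<close> exceeds that multiple infinitely often on the infinite set
  \<open>M(x, f; y)\<close>.  If all \<open>g_y\<close> are nondecreasing, this only requires \<open>g_y\<close> to escape the function
  sending \<open>n\<close> to the multiple of \<open>f'\<close> at the next element of \<open>M(x, f; y)\<close>.  Order the pairs
  \<open>(x, f)\<close> suitably: by the position of \<open>f'\<close> in a dominating family of size \<open>\<bb> = \<dd>\<close>, in type
  \<open>\<cc> = \<dd>\<close>, or by a model \<open>H \<alpha>\<close> containing a code of \<open>(x, f)\<close>.  Each time the functions
  to be escaped by the later of two pairs are bounded, or fewer than \<open>\<dd>\<close>, or members of a
  single model, and hence not dominating.\<close>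

section \<open>Reduction to a statement about distance functions\<close>

definition far :: "(nat \<Rightarrow> real) \<Rightarrow> (nat \<Rightarrow> nat) \<Rightarrow> nat set"
  where "far \<delta> g = {n. 1 / real (g n) \<le> \<delta> n}"

text \<open>Abstract form of the principle: an index stands for a pair \<open>(x, f)\<close>,
  \<open>D i j n\<close> for the distance of the two points at \<open>n\<close>, and
  \<open>G i\<close> for the function called \<open>f'\<close> above. Positivity of \<open>F\<close>
  makes \<open>1 / real (F i n)\<close> agree with \<open>recip (F i n)\<close>; at 0 the former is
  0, the latter infinite.\<close>

definition resolvable :: "'i set \<Rightarrow> ('i \<Rightarrow> 'i \<Rightarrow> nat \<Rightarrow> real) \<Rightarrow> ('i \<Rightarrow> nat \<Rightarrow> nat) \<Rightarrow> bool"
  where "resolvable I D G \<longleftrightarrow>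
    (\<exists>F. (\<forall>i\<in>I. \<forall>n. 0 < F i n) \<and>
      (\<forall>i\<in>I. \<forall>j\<in>I. infinite (far (D i j) (G i)) \<longrightarrow> infinite (far (D i j) (G j)) \<longrightarrow>
        infinite {n. 1 / real (F i n) + 1 / real (F j n) < D i j n}))"

text \<open>As \<open>D\<close> is symmetric, it suffices to treat pairs in the order
  \<open>L\<close>, using the far set of the first index. Totality is asked only when that set is
  infinite, so a strict order serves if distances to oneself vanish and \<open>G\<close> is
  positive.\<close>

lemma resolvableI:
  assumes sym: "\<And>i j n. D i j n = D j i n"
    and pos: "\<And>i n. i \<in> I \<Longrightarrow> 0 < F i n"
    and total: "\<And>i j. i \<in> I \<Longrightarrow> j \<in> I \<Longrightarrow> infinite (far (D i j) (G i)) \<Longrightarrow> L i j \<or> L j i"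
    and step: "\<And>i j. i \<in> I \<Longrightarrow> j \<in> I \<Longrightarrow> L i j \<Longrightarrow> infinite (far (D i j) (G i)) \<Longrightarrow>
      infinite {n. 1 / real (F i n) + 1 / real (F j n) < D i j n}"
  shows "resolvable I D G"
  unfolding resolvable_def
proof (intro exI[of _ F] conjI ballI allI impI)
  fix i j assume ij: "i \<in> I" "j \<in> I"
    and inf: "infinite (far (D i j) (G i))" "infinite (far (D i j) (G j))"
  have comm: "D j i = D i j" using sym by auto
  from total[OF ij inf(1)] show "infinite {n. 1 / real (F i n) + 1 / real (F j n) < D i j n}"
  proof
    assume "L j i"
    from step[OF ij(2,1) this] inf(2) show ?thesis unfolding comm by (simp add: add.commute)
  qed (use step ij inf in blast)
qed (use pos in auto)

lemma inverse_add_less: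
  fixes a b c :: nat
  assumes "0 < c" "2 * c < a" "2 * c < b" "1 / real c \<le> \<delta>"
  shows "1 / real a + 1 / real b < \<delta>"
proof -
  have "1 / real a < 1 / (2 * real c)" "1 / real b < 1 / (2 * real c)"
    using assms by (intro divide_strict_left_mono; simp)+
  moreover have "1 / (2 * real c) + 1 / (2 * real c) = 1 / real c" by simp
  ultimately show ?thesis using assms(4) by linarith
qed

section \<open>From balls in the factors to lower bounds on distances\<close>

lemma compatible_metricD:
  assumes "compatible_metric X d"
  shows "Metric_space (topspace X) d" "Metric_space.mtopology (topspace X) d = X"
  using assms by (auto simp: compatible_metric_def)

text \<open>If \<open>a\<close> is isolated, some metric ball lies inside \<open>{a}\<close>, and
  its radius bounds the other distances from below; otherwise \<open>recip m\<close> itself does.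
  The point is that \<open>k\<close> does not depend on \<open>y\<close>.\<close>

lemma outside_Bball_far:
  assumes "compatible_metric X d" "a \<in> topspace X"
  shows "\<exists>k>0. \<forall>y\<in>topspace X. y \<notin> Bball X d a (recip m) \<longrightarrow> 1 / real k \<le> d a y"
proof (cases "isolated_point X a")
  case True
  interpret Metric_space "topspace X" d by (rule compatible_metricD[OF assms(1)])
  have "openin mtopology {a}"
    using True compatible_metricD(2)[OF assms(1)] by (simp add: isolated_point_def)
  then obtain r where r: "r > 0" "mball a r \<subseteq> {a}" by (auto simp: openin_mtopology)
  obtain k where k: "inverse (real (Suc k)) < r" using r(1) reals_Archimedean by blast
  have "1 / real (Suc k) \<le> d a y" if "y \<in> topspace X" "y \<notin> Bball X d a (recip m)" for y
  proof -
    have "y \<notin> mball a r" using that True r by (auto simp: Bball_def)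
    then have "r \<le> d a y" using that assms(2) by (auto simp: in_mball)
    then show ?thesis using k by (simp add: inverse_eq_divide)
  qed
  then show ?thesis by blast
next
  case False
  show ?thesis
  proof (cases "m = 0")
    case True
    \<comment> \<open>Here \<open>recip m\<close> is infinite, so no point of the space lies outside
      the ball and any \<open>k\<close> works.\<close>
    then show ?thesis using False by (auto simp: Bball_def recip_def intro!: exI[of _ 1])
  next
    case m: False
    then show ?thesis using False by (intro exI[of _ m]) (auto simp: Bball_def recip_def)
  qed
qed

lemma Mset_subset_far:
  assumes compat: "\<And>n. compatible_metric (X n) (d n)"
    and x: "x \<in> (\<Pi> n\<in>UNIV. topspace (X n))"
  shows "\<exists>g. (\<forall>n. 0 < g n) \<and>
    (\<forall>y\<in>(\<Pi> n\<in>UNIV. topspace (X n)). Mset X d x f y \<subseteq> far (\<lambda>n. d n (x n) (y n)) g)"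
proof -
  have "\<exists>k>0. \<forall>y\<in>topspace (X n). y \<notin> Bball (X n) (d n) (x n) (recip (f n)) \<longrightarrow>
      1 / real k \<le> d n (x n) y" for n
    using outside_Bball_far[OF compat Pi_mem[OF x]] by simp
  then obtain g where "\<And>n. 0 < g n \<and> (\<forall>y\<in>topspace (X n).
      y \<notin> Bball (X n) (d n) (x n) (recip (f n)) \<longrightarrow> 1 / real (g n) \<le> d n (x n) y)"
    by metis
  then show ?thesis by (intro exI[of _ g]) (auto simp: Mset_def far_def Pi_iff)
qed

section \<open>Canonical representatives of points of the nabla product\<close>

definition nabla_rep :: "(nat \<Rightarrow> 'a) set \<Rightarrow> nat \<Rightarrow> 'a"
  where "nabla_rep p = (SOME x. x \<in> p)"

lemma nabla_rep:
  assumes "p \<in> nabla X"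
  shows "nabla_rep p \<in> p" "nabla_rep p \<in> (\<Pi> n\<in>UNIV. topspace (X n))"
proof -
  show *: "nabla_rep p \<in> p"
    unfolding nabla_rep_def
    using in_quotient_imp_non_empty[OF equiv_sim assms[unfolded nabla_def]] by (simp add: some_in_eq)
  show "nabla_rep p \<in> (\<Pi> n\<in>UNIV. topspace (X n))"
    using in_quotient_imp_subset[OF equiv_sim assms[unfolded nabla_def]] * by blast
qed

lemma nabla_memD:
  assumes "p \<in> nabla X" "x \<in> p"
  shows "finite {n. nabla_rep p n \<noteq> x n}" "x \<in> (\<Pi> n\<in>UNIV. topspace (X n))"
proof -
  have "(nabla_rep p, x) \<in> sim X"
    using in_quotient_imp_in_rel[OF equiv_sim assms(1)[unfolded nabla_def]] nabla_rep(1)[OF assms(1)]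
      assms(2) by blast
  then show "finite {n. nabla_rep p n \<noteq> x n}" "x \<in> (\<Pi> n\<in>UNIV. topspace (X n))"
    by (auto simp: sim_def)
qed

lemma inj_on_nabla_rep: "inj_on nabla_rep (nabla X)"
proof (rule inj_onI)
  fix p q assume pq: "p \<in> nabla X" "q \<in> nabla X" "nabla_rep p = nabla_rep q"
  then have "p \<inter> q \<noteq> {}" using nabla_rep(1)[of p X] nabla_rep(1)[of q X] by auto
  then show "p = q"
    using quotient_disj[OF equiv_sim pq(1,2)[unfolded nabla_def]] by blast
qed

definition rep_dist ::
    "(nat \<Rightarrow> 'a \<Rightarrow> 'a \<Rightarrow> real) \<Rightarrow> (nat \<Rightarrow> 'a) set \<times> 'f \<Rightarrow> (nat \<Rightarrow> 'a) set \<times> 'f \<Rightarrow> nat \<Rightarrow> real"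
  where "rep_dist d i j n = d n (nabla_rep (fst i) n) (nabla_rep (fst j) n)"

text \<open>Distances are measured between canonical representatives, while the principle allows
  arbitrary ones. The two differ at only finitely many \<open>n\<close>, so infinite sets stay
  infinite.\<close>

lemma Delta_metric_if_resolvable:
  fixes X :: "nat \<Rightarrow> 'a topology"
  assumes compat: "\<And>n. compatible_metric (X n) (d n)"
    and res: "\<And>G :: (nat \<Rightarrow> 'a) set \<times> (nat \<Rightarrow> nat) \<Rightarrow> nat \<Rightarrow> nat.
      (\<And>i n. i \<in> nabla X \<times> UNIV \<Longrightarrow> 0 < G i n) \<Longrightarrow> resolvable (nabla X \<times> UNIV) (rep_dist d) G"
  shows "Delta_metric X d"
proof -
  define P where "P i g \<longleftrightarrow> (\<forall>n. 0 < g n) \<and> (\<forall>y\<in>(\<Pi> n\<in>UNIV. topspace (X n)).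
      Mset X d (nabla_rep (fst i)) (snd i) y \<subseteq> far (\<lambda>n. d n (nabla_rep (fst i) n) (y n)) g)"
    for i :: "(nat \<Rightarrow> 'a) set \<times> (nat \<Rightarrow> nat)" and g
  have "\<forall>i\<in>nabla X \<times> UNIV. \<exists>g. P i g"
    unfolding P_def using Mset_subset_far[OF compat nabla_rep(2)] by fastforce
  from bchoice[OF this] obtain G where "\<forall>i\<in>nabla X \<times> UNIV. P i (G i)" by blast
  then have Gpos: "\<And>i n. i \<in> nabla X \<times> UNIV \<Longrightarrow> 0 < G i n"
    and Gfar: "\<And>i y. i \<in> nabla X \<times> UNIV \<Longrightarrow> y \<in> (\<Pi> n\<in>UNIV. topspace (X n)) \<Longrightarrow>
      Mset X d (nabla_rep (fst i)) (snd i) y \<subseteq> far (\<lambda>n. d n (nabla_rep (fst i) n) (y n)) (G i)"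
    unfolding P_def by blast+
  have "resolvable (nabla X \<times> UNIV) (rep_dist d) G"
    using Gpos by (rule res)
  then obtain F where "\<forall>i\<in>nabla X \<times> UNIV. \<forall>n. 0 < F i n" and
    "\<forall>i\<in>nabla X \<times> UNIV. \<forall>j\<in>nabla X \<times> UNIV.
      infinite (far (rep_dist d i j) (G i)) \<longrightarrow> infinite (far (rep_dist d i j) (G j)) \<longrightarrow>
      infinite {n. 1 / real (F i n) + 1 / real (F j n) < rep_dist d i j n}"
    unfolding resolvable_def by blast
  then have Fpos: "\<And>i n. i \<in> nabla X \<times> UNIV \<Longrightarrow> 0 < F i n"
    and F: "\<And>i j. i \<in> nabla X \<times> UNIV \<Longrightarrow> j \<in> nabla X \<times> UNIV \<Longrightarrow>
      infinite (far (rep_dist d i j) (G i)) \<Longrightarrow> infinite (far (rep_dist d i j) (G j)) \<Longrightarrow>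
      infinite {n. 1 / real (F i n) + 1 / real (F j n) < rep_dist d i j n}"
    by blast+
  have dcomm: "d n a b = d n b a" for n a b
    using Metric_space.commute[OF compatible_metricD(1)[OF compat]] .
  have far: "infinite (far (rep_dist d (p, f) (q, g)) (G (p, f)))"
    if pq: "p \<in> nabla X" "q \<in> nabla X" and xy: "x \<in> p" "y \<in> q"
      and inf: "infinite (Mset X d x f y)" for p q x y f g
  proof
    assume "finite (far (rep_dist d (p, f) (q, g)) (G (p, f)))"
    then have fin: "finite (far (rep_dist d (p, f) (q, g)) (G (p, f)) \<union>
        {n. nabla_rep p n \<noteq> x n} \<union> {n. nabla_rep q n \<noteq> y n})"
      using nabla_memD(1) pq xy by auto
    have "Mset X d x f y \<subseteq> far (rep_dist d (p, f) (q, g)) (G (p, f)) \<union>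
        {n. nabla_rep p n \<noteq> x n} \<union> {n. nabla_rep q n \<noteq> y n}"
    proof
      fix n assume n: "n \<in> Mset X d x f y"
      show "n \<in> far (rep_dist d (p, f) (q, g)) (G (p, f)) \<union>
        {n. nabla_rep p n \<noteq> x n} \<union> {n. nabla_rep q n \<noteq> y n}"
      proof (cases "nabla_rep p n = x n \<and> nabla_rep q n = y n")
        case True
        then have "n \<in> Mset X d (nabla_rep p) f (nabla_rep q)" using n by (simp add: Mset_def)
        then show ?thesis
          using Gfar[of "(p, f)" "nabla_rep q"] pq nabla_rep(2)[OF pq(2)]
          by (auto simp: far_def rep_dist_def)
      qed auto
    qed
    with inf fin show False using finite_subset by blast
  qed
  show ?thesis
    unfolding Delta_metric_def
  proof (intro exI[of _ F] ballI allI impI)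
    fix p q x y f g
    assume pq: "p \<in> nabla X" "q \<in> nabla X" and xy: "x \<in> p" "y \<in> q"
      and sw: "switch X d (x, f) (y, g)"
    \<comment> \<open>Symmetry turns the far set obtained for the reversed pair into one for the
      same distance function.\<close>
    have "rep_dist d (q, g) (p, f) = rep_dist d (p, f) (q, g)"
      using dcomm by (auto simp: rep_dist_def)
    then have inf: "infinite {n. 1 / real (F (p, f) n) + 1 / real (F (q, g) n)
        < rep_dist d (p, f) (q, g) n}"
      using F[of "(p, f)" "(q, g)"] far[of p q x y f g] far[of q p y x g f] pq xy sw
      by (simp add: switch_def)
    show "infinite {n. recip (F (p, f) n) + recip (F (q, g) n) < ereal (d n (x n) (y n))}"
    proof
      assume "finite {n. recip (F (p, f) n) + recip (F (q, g) n) < ereal (d n (x n) (y n))}"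
      then have "finite ({n. recip (F (p, f) n) + recip (F (q, g) n) < ereal (d n (x n) (y n))}
          \<union> {n. nabla_rep p n \<noteq> x n} \<union> {n. nabla_rep q n \<noteq> y n})"
        using nabla_memD(1) pq xy by auto
      moreover have "recip (F (p, f) n) = ereal (1 / real (F (p, f) n))"
        "recip (F (q, g) n) = ereal (1 / real (F (q, g) n))" for n
        using Fpos[of "(p, f)" n] Fpos[of "(q, g)" n] pq by (auto simp: recip_def)
      then have "{n. 1 / real (F (p, f) n) + 1 / real (F (q, g) n) < rep_dist d (p, f) (q, g) n}
          \<subseteq> {n. recip (F (p, f) n) + recip (F (q, g) n) < ereal (d n (x n) (y n))}
          \<union> {n. nabla_rep p n \<noteq> x n} \<union> {n. nabla_rep q n \<noteq> y n}"
        by (auto simp: rep_dist_def)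
      ultimately show False using inf finite_subset by blast
    qed
  qed
qed

lemma rep_dist_commute:
  assumes "\<And>n. compatible_metric (X n) (d n)"
  shows "rep_dist d i j n = rep_dist d j i n"
  using Metric_space.commute[OF compatible_metricD(1)[OF assms]] by (simp add: rep_dist_def)

lemma rep_dist_self:
  assumes "\<And>n. compatible_metric (X n) (d n)" "i \<in> nabla X \<times> UNIV"
  shows "rep_dist d i i n = 0"
proof -
  have "nabla_rep (fst i) n \<in> topspace (X n)" using Pi_mem[OF nabla_rep(2)] assms(2) by fastforce
  then show ?thesis
    using Metric_space.mdist_zero[OF compatible_metricD(1)[OF assms(1)]] by (simp add: rep_dist_def)
qed

lemma exists_compatible_metric:
  assumes "metrizable_space X"
  shows "\<exists>d. compatible_metric X d"
proof -
  obtain M d where "Metric_space M d" "X = Metric_space.mtopology M d"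
    using assms by (auto simp: metrizable_space_def)
  then show ?thesis
    by (intro exI[of _ d]) (auto simp: compatible_metric_def Metric_space.topspace_mtopology)
qed

lemma Delta_spaces_if_resolvable:
  fixes X :: "nat \<Rightarrow> 'a topology"
  assumes metr: "\<And>n. metrizable_space (X n)"
    and res: "\<And>d (G :: (nat \<Rightarrow> 'a) set \<times> (nat \<Rightarrow> nat) \<Rightarrow> nat \<Rightarrow> nat).
      (\<And>n. compatible_metric (X n) (d n)) \<Longrightarrow> (\<And>i n. i \<in> nabla X \<times> UNIV \<Longrightarrow> 0 < G i n) \<Longrightarrow>
      resolvable (nabla X \<times> UNIV) (rep_dist d) G"
  shows "Delta_spaces X"
proof -
  obtain d where d: "\<And>n. compatible_metric (X n) (d n)"
    using exists_compatible_metric[OF metr] by metis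
  then show ?thesis
    unfolding Delta_spaces_def using Delta_metric_if_resolvable[OF d res[OF d]] by blast
qed


section \<open>The cases \<open>\<bb> = \<dd>\<close> and \<open>\<dd> = \<cc>\<close>\<close>

lemma not_unbounded_if_less:
  assumes "|B| <o \<bb>"
  shows "\<exists>g. \<forall>f\<in>B. f \<le>* g"
proof (rule ccontr)
  assume "\<not> ?thesis"
  then have "unbounded_family B" by (simp add: unbounded_family_def)
  then have "\<bb> \<le>o |B|" unfolding bounding_number_def by (rule min_card_le)
  with assms show False using not_ordLess_ordLeq by blast
qed

lemma not_dominating_if_less:
  assumes "|B| <o \<dd>"
  shows "\<not> dominating_family B"
proof
  assume "dominating_family B"
  then have "\<dd> \<le>o |B|" unfolding dominating_number_def by (rule min_card_le)
  with assms show False using not_ordLess_ordLeq by blast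
qed

text \<open>\<open>|A|\<close> is itself a well-order of \<open>A\<close> of least possible type, so
  its proper initial segments have cardinality strictly less than \<open>A\<close>.\<close>

abbreviation below :: "'i set \<Rightarrow> 'i \<Rightarrow> 'i set"
  where "below A a \<equiv> underS ( |A| ) a"

lemma card_of_below_total:
  assumes "a \<in> A" "b \<in> A"
  shows "a \<in> below A b \<or> b \<in> below A a \<or> a = b"
proof -
  have "total_on A |A|"
    using card_of_Well_order[of A] by (simp add: well_order_on_def linear_order_on_def Field_card_of)
  then show ?thesis using assms by (auto simp: total_on_def underS_def)
qed

lemma le_starD: "f \<le>* g \<Longrightarrow> \<forall>\<^sub>\<infinity>n. f n \<le> g n"
  by (simp add: le_star_def cofinite_eq_sequentially[symmetric] eventually_cofinite)

lemma infinite_far_ev: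
  assumes "infinite (far \<delta> g)" "\<forall>\<^sub>\<infinity>n. n \<in> far \<delta> g \<longrightarrow> n \<in> B"
  shows "infinite B"
proof
  assume "finite B"
  then have "finite (B \<union> {n. \<not> (n \<in> far \<delta> g \<longrightarrow> n \<in> B)})"
    using assms(2) by (simp add: eventually_cofinite)
  then have "finite (far \<delta> g)" by (rule rev_finite_subset) blast
  with assms(1) show False by contradiction
qed

text \<open>Indices are ranked by the place of \<open>r i\<close>, eventually above
  \<open>2 * G i\<close>, in a dominating family of size \<dd>. Its initial segments are smaller
  than \<bb>, hence bounded, so the function of the later index eventually exceeds
  \<open>2 * G i\<close> outright.\<close>

lemma resolvable_if_b_eq_d:
  assumes bd: "\<bb> =o \<dd>"
    and sym: "\<And>i j n. D i j n = D j i n"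
    and Gpos: "\<And>i n. i \<in> I \<Longrightarrow> 0 < G i n"
  shows "resolvable I D G"
proof -
  obtain B where B: "dominating_family B" and dB: "\<dd> = |B|"
    using min_card_attained[of dominating_family, OF dominating_family_UNIV]
    unfolding dominating_number_def by blast
  have "\<exists>g. \<forall>f\<in>below B b. f \<le>* g" if "b \<in> B" for b
  proof (rule not_unbounded_if_less)
    have "|below B b| <o |B|"
      using card_of_underS[OF card_of_Card_order, of b B] that by (simp add: Field_card_of)
    then show "|below B b| <o \<bb>"
      using bd dB ordLess_ordIso_trans ordIso_symmetric by metis
  qed
  then obtain e where e: "\<And>b f. b \<in> B \<Longrightarrow> f \<in> below B b \<Longrightarrow> f \<le>* e b" by metis
  \<comment> \<open>Adding \<open>b\<close> itself takes care of ties \<open>r i = r j\<close>,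
    where \<open>r i\<close> is not in the segment below \<open>r j\<close>.\<close>
  define E where "E b n = e b n + b n" for b n
  have "\<exists>b\<in>B. (\<lambda>n. 2 * G i n + 1) \<le>* b" for i
    using B unfolding dominating_family_def by blast
  then obtain r where rB: "\<And>i. r i \<in> B" and r: "\<And>i. (\<lambda>n. 2 * G i n + 1) \<le>* r i" by metis
  define F where "F i n = E (r i) n + 1" for i n
  show ?thesis
  proof (rule resolvableI[where F = F and L = "\<lambda>i j. r i \<in> below B (r j) \<or> r i = r j", OF sym])
    show "0 < F i n" for i n by (simp add: F_def)
    show "(r i \<in> below B (r j) \<or> r i = r j) \<or> r j \<in> below B (r i) \<or> r j = r i" for i j
      using card_of_below_total[OF rB rB, of i j] by blast
    fix i j assume ij: "i \<in> I" "j \<in> I" and L: "r i \<in> below B (r j) \<or> r i = r j"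
      and inf: "infinite (far (D i j) (G i))"
    have i: "\<forall>\<^sub>\<infinity>n. 2 * G i n < F i n"
      using le_starD[OF r[of i]] by eventually_elim (simp add: F_def E_def)
    have "\<forall>\<^sub>\<infinity>n. r i n \<le> E (r j) n"
      using L
    proof
      assume "r i \<in> below B (r j)"
      from le_starD[OF e[OF rB this]] show ?thesis by eventually_elim (simp add: E_def)
    qed (simp add: E_def)
    with le_starD[OF r[of i]] have j: "\<forall>\<^sub>\<infinity>n. 2 * G i n < F j n"
      by eventually_elim (simp add: F_def)
    show "infinite {n. 1 / real (F i n) + 1 / real (F j n) < D i j n}"
      using i j by (intro infinite_far_ev[OF inf], eventually_elim)
        (auto simp: far_def intro: inverse_add_less[OF Gpos[OF ij(1)]])
  qed
qed

section \<open>Functions escaping a family that is not dominating\<close>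

lemma not_dominatingD:
  assumes "\<not> dominating_family B"
  shows "\<exists>g. \<forall>k\<in>B. \<exists>\<^sub>\<infinity>n. k n < g n"
proof -
  obtain g where g: "\<And>k. k \<in> B \<Longrightarrow> \<not> g \<le>* k" using assms by (auto simp: dominating_family_def)
  then have "\<exists>\<^sub>\<infinity>n. k n < g n" if "k \<in> B" for k
    using g[OF that] by (simp add: le_star_def INFM_iff_infinite not_le)
  then show ?thesis by blast
qed

text \<open>Partial sums turn an escaping function into a nondecreasing one.\<close>

lemma not_dominating_escape:
  assumes "\<not> dominating_family B"
  shows "\<exists>E. mono E \<and> (\<forall>n. h n < E n) \<and> (\<forall>k\<in>B. \<exists>\<^sub>\<infinity>n. k n < E n)"
proof -
  obtain g where g: "\<And>k. k \<in> B \<Longrightarrow> \<exists>\<^sub>\<infinity>n. k n < g n" using not_dominatingD[OF assms] by blast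
  define E where "E n = (\<Sum>i\<le>n. g i + h i + 1)" for n :: nat
  have ge: "g n + h n + 1 \<le> E n" for n
    unfolding E_def by (rule member_le_sum) auto
  have "mono E"
    unfolding E_def by (intro monoI sum_mono2) auto
  moreover have "h n < E n" for n using ge[of n] by linarith
  moreover have "\<exists>\<^sub>\<infinity>n. k n < E n" if "k \<in> B" for k
    using g[OF that] by (rule INFM_mono) (use ge less_le_trans in \<open>smt (verit) add_leE\<close>)
  ultimately show ?thesis by blast
qed

text \<open>If \<open>k n < E n\<close>, monotonicity carries the escape to some
  \<open>m \<ge> n\<close> in \<open>A\<close>: there
  \<open>h m \<le> k n < E n \<le> E m\<close>.\<close>

lemma escape_on_infinite_set:
  fixes A :: "nat set" and E h k :: "nat \<Rightarrow> nat"
  assumes E: "mono E" "\<exists>\<^sub>\<infinity>n. k n < E n"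
    and k: "\<And>n. \<exists>m\<ge>n. m \<in> A \<and> h m \<le> k n"
  shows "infinite {m \<in> A. h m < E m}"
  unfolding infinite_nat_iff_unbounded_le
proof
  fix n0
  obtain n where n: "n0 \<le> n" "k n < E n" using E(2) unfolding INFM_nat_le by blast
  obtain m where m: "m \<ge> n" "m \<in> A" "h m \<le> k n" using k by blast
  have "E n \<le> E m" using m(1) E(1) by (rule monoD[rotated])
  then show "\<exists>m\<ge>n0. m \<in> {m \<in> A. h m < E m}" using m n by (intro exI[of _ m]) auto
qed

lemma resolvable_if_card_le_d:
  assumes I: "|I| \<le>o \<dd>"
    and sym: "\<And>i j n. D i j n = D j i n"
    and self: "\<And>i n. i \<in> I \<Longrightarrow> D i i n = 0"
    and Gpos: "\<And>i n. i \<in> I \<Longrightarrow> 0 < G i n"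
  shows "resolvable I D G"
proof -
  \<comment> \<open>If the far set is finite, \<open>LEAST\<close> may be arbitrary; this does no
    harm, as only the size of \<open>K j\<close> matters for such \<open>i\<close>.\<close>
  define next' where "next' i j n = (LEAST m. n \<le> m \<and> m \<in> far (D i j) (G i))" for i j n
  define K where "K j = (\<lambda>i n. 2 * G i (next' i j n)) ` below I j" for j
  have "\<forall>j\<in>I. \<exists>E. mono E \<and> (\<forall>n. 2 * G j n < E n) \<and> (\<forall>k\<in>K j. \<exists>\<^sub>\<infinity>n. k n < E n)"
  proof (intro ballI, rule not_dominating_escape, rule not_dominating_if_less)
    fix j assume "j \<in> I"
    then have "|below I j| <o |I|"
      using card_of_underS[OF card_of_Card_order, of j I] by (simp add: Field_card_of)
    then have "|K j| <o |I|" unfolding K_def using card_of_image ordLeq_ordLess_trans by blast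
    then show "|K j| <o \<dd>" using I ordLess_ordLeq_trans by blast
  qed
  from bchoice[OF this] obtain F
    where "\<forall>j\<in>I. mono (F j) \<and> (\<forall>n. 2 * G j n < F j n) \<and> (\<forall>k\<in>K j. \<exists>\<^sub>\<infinity>n. k n < F j n)"
    by blast
  then have Fmono: "\<And>j. j \<in> I \<Longrightarrow> mono (F j)" and FG: "\<And>j n. j \<in> I \<Longrightarrow> 2 * G j n < F j n"
    and FK: "\<And>j k. j \<in> I \<Longrightarrow> k \<in> K j \<Longrightarrow> \<exists>\<^sub>\<infinity>n. k n < F j n"
    by blast+
  show ?thesis
  proof (rule resolvableI[where F = F and L = "\<lambda>i j. i \<in> below I j", OF sym])
    show "0 < F i n" if "i \<in> I" for i n using FG[OF that, of n] by linarith
    fix i j assume ij: "i \<in> I" "j \<in> I" and inf: "infinite (far (D i j) (G i))"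
    \<comment> \<open>Excludes \<open>i = j\<close>, which the strict order \<open>below\<close>
      cannot compare.\<close>
    have "far (D i i) (G i) = {}"
      using self[OF ij(1)] Gpos[OF ij(1)] by (auto simp: far_def)
    with inf have "i \<noteq> j" by auto
    with card_of_below_total[OF ij] show "i \<in> below I j \<or> j \<in> below I i" by blast
    assume L: "i \<in> below I j"
    have "\<exists>m. n \<le> m \<and> m \<in> far (D i j) (G i)" for n
      using inf unfolding infinite_nat_iff_unbounded_le by blast
    then have next': "n \<le> next' i j n \<and> next' i j n \<in> far (D i j) (G i)" for n
      unfolding next'_def by (rule LeastI_ex)
    have "infinite {m \<in> far (D i j) (G i). 2 * G i m < F j m}"
    proof (rule escape_on_infinite_set[OF Fmono[OF ij(2)] FK[OF ij(2)]])
      show "(\<lambda>n. 2 * G i (next' i j n)) \<in> K j" using L by (simp add: K_def)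
      show "\<exists>m\<ge>n. m \<in> far (D i j) (G i) \<and> 2 * G i m \<le> 2 * G i (next' i j n)" for n
        using next' by (intro exI[of _ "next' i j n"]) auto
    qed
    moreover have "{m \<in> far (D i j) (G i). 2 * G i m < F j m} \<subseteq>
        {n. 1 / real (F i n) + 1 / real (F j n) < D i j n}"
      using inverse_add_less[OF Gpos FG] ij by (auto simp: far_def)
    ultimately show "infinite {n. 1 / real (F i n) + 1 / real (F j n) < D i j n}"
      using infinite_super by blast
  qed
qed

section \<open>Counting the pairs \<open>(x, f)\<close>\<close>

lemma card_nabla_times_le_continuum:
  fixes X :: "nat \<Rightarrow> 'a topology"
  assumes "\<And>n. |topspace (X n)| \<le>o \<cc>"
  shows "|nabla X \<times> (UNIV :: (nat \<Rightarrow> nat) set)| \<le>o \<cc>"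
proof -
  have "\<exists>\<phi> :: 'a \<Rightarrow> nat set. inj_on \<phi> (topspace (X n))" for n
    using assms[of n] by (auto simp: continuum_def card_of_ordLeq[symmetric])
  then obtain \<phi> :: "nat \<Rightarrow> 'a \<Rightarrow> nat set" where \<phi>: "\<And>n. inj_on (\<phi> n) (topspace (X n))" by metis
  \<comment> \<open>The left summand stores the coordinates, as sets of numbers placed in the
    columns of the plane; the right one stores the graph of the function.\<close>
  define code :: "(nat \<Rightarrow> 'a) set \<times> (nat \<Rightarrow> nat) \<Rightarrow> nat set" where
    "code i = to_nat ` (Inl ` (SIGMA n:UNIV. \<phi> n (nabla_rep (fst i) n)) \<union>
      Inr ` range (\<lambda>n. (n, snd i n)))" for i
  have "inj_on code (nabla X \<times> UNIV)"
  proof (rule inj_onI)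
    fix i j assume i: "i \<in> nabla X \<times> UNIV" and j: "j \<in> nabla X \<times> UNIV" and eq: "code i = code j"
    have eq': "Inl ` (SIGMA n:UNIV. \<phi> n (nabla_rep (fst i) n)) \<union> Inr ` range (\<lambda>n. (n, snd i n)) =
        (Inl ` (SIGMA n:UNIV. \<phi> n (nabla_rep (fst j) n)) \<union> Inr ` range (\<lambda>n. (n, snd j n))
          :: (nat \<times> nat + nat \<times> nat) set)" (is "?L i = ?L j")
      using eq unfolding code_def by (subst (asm) inj_image_eq_iff) auto
    have "\<phi> n (nabla_rep (fst i) n) = \<phi> n (nabla_rep (fst j) n)" for n
    proof (rule set_eqI)
      fix m
      have "Inl (n, m) \<in> ?L i \<longleftrightarrow> Inl (n, m) \<in> ?L j" by (simp only: eq')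
      then show "m \<in> \<phi> n (nabla_rep (fst i) n) \<longleftrightarrow> m \<in> \<phi> n (nabla_rep (fst j) n)" by auto
    qed
    moreover have "nabla_rep (fst i) n \<in> topspace (X n)" "nabla_rep (fst j) n \<in> topspace (X n)" for n
      using Pi_mem[OF nabla_rep(2)] i j by fastforce+
    ultimately have "nabla_rep (fst i) = nabla_rep (fst j)"
      using \<phi> by (intro ext) (meson inj_onD)
    then have "fst i = fst j" by (rule inj_onD[OF inj_on_nabla_rep[of X]]) (use i j in auto)
    moreover have "snd i n = snd j n" for n
    proof -
      have "Inr (n, snd i n) \<in> ?L j" unfolding eq'[symmetric] by blast
      then show ?thesis by auto
    qed
    ultimately show "i = j" by (auto intro: prod_eqI)
  qed
  then show ?thesis unfolding continuum_def by (auto simp: card_of_ordLeq[symmetric])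
qed


section \<open>Closure properties of elementary submodels\<close>

definition All_fm :: "nat \<Rightarrow> fm \<Rightarrow> fm"
  where "All_fm i p = Neg (Exists i (Neg p))"

definition Imp_fm :: "fm \<Rightarrow> fm \<Rightarrow> fm"
  where "Imp_fm p q = Neg (Conj p (Neg q))"

lemma sat_All_fm [simp]: "sat A s (All_fm i p) \<longleftrightarrow> (\<forall>a\<in>A. sat A (s(i := a)) p)"
  by (simp add: All_fm_def)

lemma sat_Imp_fm [simp]: "sat A s (Imp_fm p q) \<longleftrightarrow> (sat A s p \<longrightarrow> sat A s q)"
  by (simp add: Imp_fm_def)

text \<open>Elementarity is used downwards to find a witness in \<open>A\<close>, then upwards to
  see that it satisfies \<open>p\<close> in the whole universe.\<close>

lemma elementary_submodel_witness:
  assumes el: "elementary_submodel A" and s: "range s \<subseteq> A"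
    and ex: "sat UNIV (s(i := a)) p"
  shows "\<exists>b\<in>A. sat UNIV (s(i := b)) p"
proof -
  have "sat UNIV s (Exists i p)" using ex by auto
  then have "sat A s (Exists i p)" using el s unfolding elementary_submodel_def by blast
  then obtain b where b: "b \<in> A" "sat A (s(i := b)) p" by auto
  moreover have "range (s(i := b)) \<subseteq> A" using b(1) s by auto
  ultimately show ?thesis using el by (auto simp: elementary_submodel_def)
qed

text \<open>The conditions make \<open>h\<close> a selector of the family \<open>R\<close>, each
  element being certified by a common member of \<open>S\<close> and \<open>T\<close>. They are
  first-order in these parameters, so any selector is matched by one in \<open>A\<close>.\<close>

lemma elementary_submodel_selector:
  assumes el: "elementary_submodel A" and mem: "S \<in> A" "T \<in> A" "R \<in> A"
    and h: "\<forall>z\<in>elems h. \<exists>c\<in>elems R. z \<in> elems c"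
      "\<forall>c\<in>elems R. \<exists>!z. z \<in> elems h \<inter> elems c"
      "\<forall>z\<in>elems h. \<exists>w\<in>elems S \<inter> elems T. z \<in> elems w"
  shows "\<exists>h\<in>A. (\<forall>z\<in>elems h. \<exists>c\<in>elems R. z \<in> elems c) \<and>
    (\<forall>c\<in>elems R. \<exists>!z. z \<in> elems h \<inter> elems c) \<and>
    (\<forall>z\<in>elems h. \<exists>w\<in>elems S \<inter> elems T. z \<in> elems w)"
proof -
  \<comment> \<open>Variable 0 is the selector, 1 and 2 are \<open>S\<close> and \<open>T\<close>, 3
    is \<open>R\<close> by default; 4, 5 and 6 are bound in the formula.\<close>
  define s where "s = (\<lambda>_ :: nat. R)(1 := S, 2 := T)"
  define \<phi> where "\<phi> = Conj
    (All_fm 4 (Imp_fm (Mem 4 0) (Exists 5 (Conj (Mem 5 3) (Mem 4 5)))))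
    (Conj (All_fm 5 (Imp_fm (Mem 5 3) (Exists 4 (Conj (Conj (Mem 4 0) (Mem 4 5))
        (All_fm 6 (Imp_fm (Conj (Mem 6 0) (Mem 6 5)) (Equal 6 4)))))))
      (All_fm 4 (Imp_fm (Mem 4 0) (Exists 5 (Conj (Conj (Mem 5 1) (Mem 5 2)) (Mem 4 5))))))"
  have sat: "sat UNIV (s(0 := h)) \<phi> \<longleftrightarrow> (\<forall>z\<in>elems h. \<exists>c\<in>elems R. z \<in> elems c) \<and>
    (\<forall>c\<in>elems R. \<exists>!z. z \<in> elems h \<inter> elems c) \<and>
    (\<forall>z\<in>elems h. \<exists>w\<in>elems S \<inter> elems T. z \<in> elems w)" for h
    unfolding \<phi>_def s_def Ex1_def by (simp add: Ball_def Bex_def conj_assoc)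
  have "range s \<subseteq> A" using mem by (auto simp: s_def)
  from elementary_submodel_witness[OF el this, of 0 h \<phi>] show ?thesis
    unfolding sat using h by blast
qed

section \<open>Coding numbers, pairs and relations as sets\<close>

lemma elems_irrefl: "x \<notin> elems x"
  using wf_elems by (auto dest: wf_not_refl)

lemma elems_hc_nat: "elems (hc_nat n) = hc_nat ` {..<n}"
proof (induction n)
  case (Suc n)
  then show ?case by (simp add: elems_hset lessThan_Suc)
qed (simp add: elems_hset)

lemma hc_nat_inject [simp]: "hc_nat m = hc_nat n \<longleftrightarrow> m = n"
proof -
  have "hc_nat m \<noteq> hc_nat n" if "m < n" for m n
  proof -
    have "hc_nat m \<in> elems (hc_nat n)" unfolding elems_hc_nat using that by blast
    then show ?thesis using elems_irrefl by auto
  qed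
  then show ?thesis by (metis linorder_neqE_nat)
qed

lemma hset_inject: "countable A \<Longrightarrow> countable B \<Longrightarrow> hset A = hset B \<longleftrightarrow> A = B"
  by (metis elems_hset)

lemma hc_pair_inject [simp]: "hc_pair a b = hc_pair c d \<longleftrightarrow> a = c \<and> b = d"
  by (auto simp: hc_pair_def hset_inject doubleton_eq_iff)

text \<open>A numeral is empty or contains the empty set, whereas a pair is nonempty and has only
  nonempty elements.\<close>

lemma hc_nat_neq_hc_pair [simp]: "hc_nat t \<noteq> hc_pair x y" "hc_pair x y \<noteq> hc_nat t"
proof -
  have "elems (hc_pair x y) = {hset {x}, hset {x, y}}" by (simp add: hc_pair_def elems_hset)
  moreover have "elems (hc_nat t) \<noteq> {hset {x}, hset {x, y}}"
  proof (cases t)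
    case (Suc m)
    have "hc_nat 0 \<noteq> hset {x}" "hc_nat 0 \<noteq> hset {x, y}" by (simp_all add: hset_inject)
    moreover have "hc_nat 0 \<in> elems (hc_nat t)" unfolding elems_hc_nat Suc by blast
    ultimately show ?thesis by auto
  qed (simp add: elems_hset)
  ultimately show "hc_nat t \<noteq> hc_pair x y" by metis
  then show "hc_pair x y \<noteq> hc_nat t" by metis
qed

text \<open>An unordered pair can be decoded since no numeral is a pair. Keeping \<open>n\<close>
  and \<open>j\<close> in one element lets plain membership extract a point of a graph;
  \<open>t\<close> is a mere certificate.\<close>

definition triple :: "nat \<Rightarrow> nat \<Rightarrow> nat \<Rightarrow> hc"
  where "triple n j t = hset {hc_pair (hc_nat n) (hc_nat j), hc_nat t}"

lemma elems_triple: "elems (triple n j t) = {hc_pair (hc_nat n) (hc_nat j), hc_nat t}"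
  by (simp add: triple_def elems_hset)

lemma triple_inject [simp]: "triple n j t = triple n' j' t' \<longleftrightarrow> n = n' \<and> j = j' \<and> t = t'"
  by (auto simp: triple_def hset_inject doubleton_eq_iff)

definition triples :: "(nat \<Rightarrow> nat \<Rightarrow> nat \<Rightarrow> bool) \<Rightarrow> hc"
  where "triples P = hset {triple n j t | n j t. P n j t}"

lemma elems_triples: "elems (triples P) = {triple n j t | n j t. P n j t}"
proof -
  have "{triple n j t | n j t. P n j t} \<subseteq> range (\<lambda>(n, j, t). triple n j t)"
    by (fastforce intro: image_eqI[where x = "(n, j, t)" for n j t])
  then have "countable {triple n j t | n j t. P n j t}" by (rule countable_subset) simp
  then show ?thesis by (simp add: triples_def elems_hset)
qed

text \<open>The vertical lines of \<open>\<omega> \<times> \<omega>\<close>: as a parameter, this set makes ``\<open>h\<close> is an element of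
  \<open>\<omega>\<^sup>\<omega>\<close>'' expressible without formalizing numbers or ordered pairs in the object language.\<close>

definition column_set :: hc
  where "column_set = hset (range (\<lambda>n. hset (range (\<lambda>j. hc_pair (hc_nat n) (hc_nat j)))))"

lemma elems_column_set: "elems column_set = range (\<lambda>n. hset (range (\<lambda>j. hc_pair (hc_nat n) (hc_nat j))))"
  by (simp add: column_set_def elems_hset)

lemma elems_hc_fun: "elems (hc_fun k) = range (\<lambda>n. hc_pair (hc_nat n) (hc_nat (k n)))"
  by (simp add: hc_fun_def elems_hset)

text \<open>Intersecting the two sets of triples expresses the conjunction of \<open>P\<close> and
  \<open>Q\<close>, and a selector of the columns is the graph of a function. So a choice function
  found in the universe is reflected to one coded in \<open>A\<close>.\<close>

lemma elementary_submodel_choice: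
  assumes el: "elementary_submodel A"
    and mem: "triples P \<in> A" "triples Q \<in> A" "column_set \<in> A"
    and ex: "\<And>n. \<exists>j t. P n j t \<and> Q n j t"
  shows "\<exists>k. hc_fun k \<in> A \<and> (\<forall>n. \<exists>t. P n (k n) t \<and> Q n (k n) t)"
proof -
  obtain k0 where k0: "\<And>n. \<exists>t. P n (k0 n) t \<and> Q n (k0 n) t" using ex by metis
  have "\<exists>h\<in>A. (\<forall>z\<in>elems h. \<exists>c\<in>elems column_set. z \<in> elems c) \<and>
    (\<forall>c\<in>elems column_set. \<exists>!z. z \<in> elems h \<inter> elems c) \<and>
    (\<forall>z\<in>elems h. \<exists>w\<in>elems (triples P) \<inter> elems (triples Q). z \<in> elems w)"
  proof (rule elementary_submodel_selector[OF el mem, of "hc_fun k0"])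
    show "\<forall>z\<in>elems (hc_fun k0). \<exists>c\<in>elems column_set. z \<in> elems c"
      by (auto simp: elems_hc_fun elems_column_set elems_hset)
    show "\<forall>c\<in>elems column_set. \<exists>!z. z \<in> elems (hc_fun k0) \<inter> elems c"
      by (auto simp: elems_hc_fun elems_column_set elems_hset)
    show "\<forall>z\<in>elems (hc_fun k0). \<exists>w\<in>elems (triples P) \<inter> elems (triples Q). z \<in> elems w"
    proof
      fix z assume "z \<in> elems (hc_fun k0)"
      then obtain n where z: "z = hc_pair (hc_nat n) (hc_nat (k0 n))" by (auto simp: elems_hc_fun)
      obtain t where "P n (k0 n) t \<and> Q n (k0 n) t" using k0 by blast
      then show "\<exists>w\<in>elems (triples P) \<inter> elems (triples Q). z \<in> elems w"
        using z by (intro bexI[of _ "triple n (k0 n) t"]) (auto simp: elems_triples elems_triple)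
    qed
  qed
  then obtain h where hA: "h \<in> A"
    and h: "\<forall>z\<in>elems h. \<exists>c\<in>elems column_set. z \<in> elems c"
      "\<forall>c\<in>elems column_set. \<exists>!z. z \<in> elems h \<inter> elems c"
      "\<forall>z\<in>elems h. \<exists>w\<in>elems (triples P) \<inter> elems (triples Q). z \<in> elems w"
    by (elim bexE conjE)
  have ex1: "\<exists>!j. hc_pair (hc_nat n) (hc_nat j) \<in> elems h" for n
  proof -
    have "\<exists>!z. z \<in> elems h \<and> z \<in> range (\<lambda>j. hc_pair (hc_nat n) (hc_nat j))"
      using bspec[OF h(2), of "hset (range (\<lambda>j. hc_pair (hc_nat n) (hc_nat j)))"]
      by (simp add: elems_column_set elems_hset)
    then obtain z where "z \<in> elems h" "z \<in> range (\<lambda>j. hc_pair (hc_nat n) (hc_nat j))"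
      and unique: "\<And>j. hc_pair (hc_nat n) (hc_nat j) \<in> elems h \<Longrightarrow>
        hc_pair (hc_nat n) (hc_nat j) = z"
      by (elim ex1E) blast
    then obtain j where "hc_pair (hc_nat n) (hc_nat j) \<in> elems h" by blast
    then show ?thesis using unique by (intro ex1I[of _ j]) (simp, metis hc_nat_inject hc_pair_inject)
  qed
  then obtain k where k: "\<And>n. hc_pair (hc_nat n) (hc_nat (k n)) \<in> elems h" by metis
  have "elems h = elems (hc_fun k)"
  proof
    show "elems h \<subseteq> elems (hc_fun k)"
    proof
      fix z assume z: "z \<in> elems h"
      then obtain n j where nj: "z = hc_pair (hc_nat n) (hc_nat j)"
        using bspec[OF h(1) z] by (auto simp: elems_column_set elems_hset)
      then have "j = k n" using z k ex1[of n] by blast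
      then show "z \<in> elems (hc_fun k)" using nj by (auto simp: elems_hc_fun)
    qed
  qed (use k in \<open>auto simp: elems_hc_fun\<close>)
  then have "h = hc_fun k" by (simp add: elems_inject)
  moreover have "\<exists>t. P n (k n) t \<and> Q n (k n) t" for n
    using bspec[OF h(3) k[of n]] by (auto simp: elems_triples elems_triple)
  ultimately show ?thesis using hA by blast
qed


section \<open>The case of the Model Hypothesis\<close>

lemma separable_dense_sequence:
  assumes "compatible_metric X d" "separable_space X" "topspace X \<noteq> {}"
  shows "\<exists>q :: nat \<Rightarrow> 'a. range q \<subseteq> topspace X \<and>
    (\<forall>a\<in>topspace X. \<forall>\<epsilon>>0. \<exists>i. d a (q i) < \<epsilon>)"
proof -
  interpret Metric_space "topspace X" d by (rule compatible_metricD[OF assms(1)])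
  have top: "mtopology = X" by (rule compatible_metricD[OF assms(1)])
  obtain C where C: "countable C" "C \<subseteq> topspace X" "X closure_of C = topspace X"
    using assms(2) by (auto simp: separable_space_def)
  with assms(3) have "C \<noteq> {}" by (metis closure_of_empty)
  have "\<exists>i. d a (from_nat_into C i) < \<epsilon>" if a: "a \<in> topspace X" and \<epsilon>: "\<epsilon> > 0" for a \<epsilon>
  proof -
    have "a \<in> mtopology closure_of C" using a C(3) top by simp
    then obtain y where "y \<in> C" "y \<in> mball a \<epsilon>" using \<epsilon> unfolding metric_closure_of by blast
    then show ?thesis using from_nat_into_surj[OF C(1)] by (metis in_mball)
  qed
  then show ?thesis
    using C(2) range_from_nat_into_subset[OF \<open>C \<noteq> {}\<close>]
    by (intro exI[of _ "from_nat_into C"]) blast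
qed

lemma model_chain_comparable:
  assumes "model_chain \<kappa> H" "\<alpha> \<in> Field \<kappa>" "\<beta> \<in> Field \<kappa>"
  shows "H \<alpha> \<subseteq> H \<beta> \<or> H \<beta> \<subseteq> H \<alpha>"
proof (cases "\<alpha> = \<beta>")
  case False
  then have "(\<alpha>, \<beta>) \<in> \<kappa> \<or> (\<beta>, \<alpha>) \<in> \<kappa>"
    using assms by (auto simp: model_chain_def well_order_on_def linear_order_on_def total_on_def)
  then show ?thesis using assms(1) unfolding model_chain_def by blast
qed simp

lemma model_chain_common:
  assumes "model_chain \<kappa> H"
  shows "\<exists>\<alpha>\<in>Field \<kappa>. {a, b, c} \<subseteq> H \<alpha>"
proof -
  have un: "(\<Union>\<alpha>\<in>Field \<kappa>. H \<alpha>) = UNIV" using assms by (simp add: model_chain_def)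
  obtain \<alpha> \<beta> \<gamma> where "\<alpha> \<in> Field \<kappa>" "\<beta> \<in> Field \<kappa>" "\<gamma> \<in> Field \<kappa>" "a \<in> H \<alpha>" "b \<in> H \<beta>" "c \<in> H \<gamma>"
    using un by blast
  then show ?thesis
    using model_chain_comparable[OF assms, of \<alpha> \<beta>] model_chain_comparable[OF assms, of \<alpha> \<gamma>]
      model_chain_comparable[OF assms, of \<beta> \<gamma>] by blast
qed

text \<open>\<open>near\<close> and \<open>away\<close> split the relation \<open>d (x m) (y m) > 2 / j\<close>, witnessed by a point of the
  dense sequence, into one condition on \<open>(x, f)\<close> and one on \<open>y\<close>; so a model containing both
  sets of triples sees the gaps between \<open>x\<close> and \<open>y\<close> without knowing the metrics.\<close>

definition near :: "(nat \<Rightarrow> nat \<Rightarrow> real) \<Rightarrow> (nat \<Rightarrow> nat) \<Rightarrow> nat \<Rightarrow> nat \<Rightarrow> nat \<Rightarrow> bool"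
  where "near \<rho> g n j t \<longleftrightarrow> (case prod_decode t of (m, i) \<Rightarrow>
    n \<le> m \<and> j = 4 * g m \<and> \<rho> m i < 1 / (2 * real j))"

definition away :: "(nat \<Rightarrow> nat \<Rightarrow> real) \<Rightarrow> nat \<Rightarrow> nat \<Rightarrow> nat \<Rightarrow> bool"
  where "away \<rho> n j t \<longleftrightarrow> (case prod_decode t of (m, i) \<Rightarrow> 5 / (2 * real j) < \<rho> m i)"

text \<open>\<open>\<rho> i m k\<close> is meant as the distance from the point of \<open>i\<close>
  to the \<open>k\<close>-th member of a dense sequence in the \<open>m\<close>-th space. The larger
  of two models contains the near triples of the earlier index \<open>i\<close> and the away triples
  of the later \<open>j\<close>. It therefore contains a function whose value at \<open>n\<close> is
  \<open>4 * G i m\<close> for some gap \<open>m \<ge> n\<close>, and \<open>F j\<close> escapes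
  it.\<close>

lemma resolvable_if_MH:
  fixes \<rho> :: "'i \<Rightarrow> nat \<Rightarrow> nat \<Rightarrow> real"
  assumes MH: "Model_Hypothesis"
    and sym: "\<And>i j n. D i j n = D j i n"
    and Gpos: "\<And>i n. i \<in> I \<Longrightarrow> 0 < G i n"
    and tri1: "\<And>i j m k. i \<in> I \<Longrightarrow> j \<in> I \<Longrightarrow> \<rho> j m k \<le> D i j m + \<rho> i m k"
    and dense: "\<And>i m \<epsilon>. i \<in> I \<Longrightarrow> 0 < \<epsilon> \<Longrightarrow> \<exists>k. \<rho> i m k < \<epsilon>"
    and tri2: "\<And>i j m k. i \<in> I \<Longrightarrow> j \<in> I \<Longrightarrow> D i j m \<le> \<rho> i m k + \<rho> j m k"
  shows "resolvable I D G"
proof -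
  obtain \<kappa> :: "hc set rel" and H where chain: "model_chain \<kappa> H"
    using MH unfolding Model_Hypothesis_def by blast
  \<comment> \<open>Both kinds of triples are included, as \<open>i\<close> may be the earlier or
    the later index of a pair.\<close>
  have "\<exists>\<alpha>\<in>Field \<kappa>. {triples (near (\<rho> i) (G i)), triples (away (\<rho> i)), column_set} \<subseteq> H \<alpha>" for i
    by (rule model_chain_common[OF chain])
  then obtain r where rF: "\<And>i. r i \<in> Field \<kappa>"
    and r: "\<And>i. {triples (near (\<rho> i) (G i)), triples (away (\<rho> i)), column_set} \<subseteq> H (r i)"
    by metis
  have el: "elementary_submodel (H (r i))" and nd: "\<not> dominating_family {k. hc_fun k \<in> H (r i)}" for i
    using chain rF by (auto simp: model_chain_def)
  have "\<exists>E. mono E \<and> (\<forall>n. 4 * G i n < E n) \<and> (\<forall>k\<in>{k. hc_fun k \<in> H (r i)}. \<exists>\<^sub>\<infinity>n. k n < E n)" for i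
    by (rule not_dominating_escape[OF nd])
  then obtain F where Fmono: "\<And>i. mono (F i)" and FG: "\<And>i n. 4 * G i n < F i n"
    and FH: "\<And>i k. hc_fun k \<in> H (r i) \<Longrightarrow> \<exists>\<^sub>\<infinity>n. k n < F i n"
    by (metis mem_Collect_eq)
  show ?thesis
  proof (rule resolvableI[where F = F and L = "\<lambda>i j. H (r i) \<subseteq> H (r j)", OF sym])
    show "0 < F i n" for i n using FG[of i n] by linarith
    show "H (r i) \<subseteq> H (r j) \<or> H (r j) \<subseteq> H (r i)" for i j
      by (rule model_chain_comparable[OF chain rF rF])
    fix i j assume ij: "i \<in> I" "j \<in> I" and L: "H (r i) \<subseteq> H (r j)"
      and inf: "infinite (far (D i j) (G i))"
    have "\<exists>l t. near (\<rho> i) (G i) n l t \<and> away (\<rho> j) n l t" for n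
    proof -
      obtain m where m: "n \<le> m" "1 / real (G i m) \<le> D i j m"
        using inf by (auto simp: infinite_nat_iff_unbounded_le far_def)
      have pos: "0 < real (G i m)" using Gpos[OF ij(1)] by simp
      \<comment> \<open>With \<open>l = 4 * G i m\<close> the distance is at least
        \<open>4 / l\<close>, so a dense point within \<open>1 / (2 * l)\<close> of the first point
        is more than \<open>5 / (2 * l)\<close> away from the second.\<close>
      obtain k where k: "\<rho> i m k < 1 / (8 * real (G i m))"
        using dense[OF ij(1), of "1 / (8 * real (G i m))" m] pos by auto
      have "5 / (8 * real (G i m)) < 1 / real (G i m) - 1 / (8 * real (G i m))"
        using pos by (simp add: field_simps)
      also have "\<dots> < \<rho> j m k" using k m(2) tri2[OF ij, of m k] by linarith
      finally show ?thesis
        using m(1) k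
        by (intro exI[of _ "4 * G i m"] exI[of _ "prod_encode (m, k)"]) (simp add: near_def away_def)
    qed
    then obtain k where kH: "hc_fun k \<in> H (r j)"
      and k: "\<And>n. \<exists>t. near (\<rho> i) (G i) n (k n) t \<and> away (\<rho> j) n (k n) t"
      using elementary_submodel_choice[OF el[of j], of "near (\<rho> i) (G i)" "away (\<rho> j)"]
        r[of i] r[of j] L by blast
    \<comment> \<open>The certificates guarantee only half the gap promised by \<open>far\<close>;
      the factor 4 in \<open>F\<close> makes two reciprocals fit under it.\<close>
    have "infinite {m \<in> {m. 2 / real (4 * G i m) < D i j m}. 4 * G i m < F j m}"
    proof (rule escape_on_infinite_set[OF Fmono FH[OF kH]])
      fix n
      obtain t where t: "near (\<rho> i) (G i) n (k n) t" "away (\<rho> j) n (k n) t" using k by blast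
      obtain m l where ml: "prod_decode t = (m, l)" by fastforce
      have "n \<le> m" and kn: "k n = 4 * G i m"
        and less: "\<rho> i m l < 1 / (2 * real (k n))" "5 / (2 * real (k n)) < \<rho> j m l"
        using t ml by (auto simp: near_def away_def)
      have "2 / real (k n) = 5 / (2 * real (k n)) - 1 / (2 * real (k n))"
        by (simp add: field_simps)
      also have "\<dots> < D i j m" using less tri1[OF ij, of m l] by linarith
      finally show "\<exists>m\<ge>n. m \<in> {m. 2 / real (4 * G i m) < D i j m} \<and> 4 * G i m \<le> k n"
        using \<open>n \<le> m\<close> kn by auto
    qed
    moreover have "{m \<in> {m. 2 / real (4 * G i m) < D i j m}. 4 * G i m < F j m} \<subseteq>
        {n. 1 / real (F i n) + 1 / real (F j n) < D i j n}"
    proof clarify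
      fix m assume m: "2 / real (4 * G i m) < D i j m" "4 * G i m < F j m"
      have pos: "0 < G i m" using Gpos[OF ij(1)] .
      have "1 / real (F i m) \<le> 1 / real (4 * G i m)" "1 / real (F j m) \<le> 1 / real (4 * G i m)"
        using FG[of i m] m(2) pos by (intro divide_left_mono; simp)+
      then show "1 / real (F i m) + 1 / real (F j m) < D i j m" using m(1) by linarith
    qed
    ultimately show "infinite {n. 1 / real (F i n) + 1 / real (F j n) < D i j n}"
      using infinite_super by blast
  qed
qed

lemma resolvable_nabla_if_MH:
  fixes X :: "nat \<Rightarrow> 'a topology"
  assumes MH: "Model_Hypothesis" and compat: "\<And>n. compatible_metric (X n) (d n)"
    and sep: "\<And>n. separable_space (X n)"
    and Gpos: "\<And>i n. i \<in> nabla X \<times> UNIV \<Longrightarrow> 0 < G i n"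
  shows "resolvable (nabla X \<times> UNIV) (rep_dist d) G"
\<comment> \<open>Dense sequences need nonempty factors; an empty factor leaves no indices to
  resolve.\<close>
proof (cases "\<exists>n. topspace (X n) = {}")
  case True
  then have "(\<Pi> n\<in>UNIV. topspace (X n)) = {}" by blast
  then have "nabla X = {}" by (simp add: nabla_def)
  then show ?thesis by (simp add: resolvable_def)
next
  case False
  have "\<exists>q :: nat \<Rightarrow> 'a. range q \<subseteq> topspace (X n) \<and>
      (\<forall>a\<in>topspace (X n). \<forall>\<epsilon>>0. \<exists>i. d n a (q i) < \<epsilon>)" for n
    using separable_dense_sequence[OF compat sep] False by blast
  then obtain q :: "nat \<Rightarrow> nat \<Rightarrow> 'a" where q: "\<And>n i. q n i \<in> topspace (X n)"
    and qd: "\<And>n a \<epsilon>. a \<in> topspace (X n) \<Longrightarrow> 0 < \<epsilon> \<Longrightarrow> \<exists>i. d n a (q n i) < \<epsilon>"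
    by (metis range_subsetD)
  have M: "Metric_space (topspace (X n)) (d n)" for n by (rule compatible_metricD[OF compat])
  have rep: "nabla_rep (fst i) n \<in> topspace (X n)" if "i \<in> nabla X \<times> UNIV" for i n
    using Pi_mem[OF nabla_rep(2)] that by fastforce
  show ?thesis
  proof (rule resolvable_if_MH[OF MH rep_dist_commute[OF compat] Gpos,
        where \<rho> = "\<lambda>i m k. d m (nabla_rep (fst i) m) (q m k)"])
    fix i j :: "(nat \<Rightarrow> 'a) set \<times> 'b" and m k
    assume i: "i \<in> nabla X \<times> UNIV" and j: "j \<in> nabla X \<times> UNIV"
    show "d m (nabla_rep (fst j) m) (q m k) \<le> rep_dist d i j m + d m (nabla_rep (fst i) m) (q m k)"
      using Metric_space.triangle[OF M rep[OF j] rep[OF i] q] Metric_space.commute[OF M]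
      by (simp add: rep_dist_def)
    show "rep_dist d i j m \<le> d m (nabla_rep (fst i) m) (q m k) + d m (nabla_rep (fst j) m) (q m k)"
      using Metric_space.triangle[OF M rep[OF i] q rep[OF j], of m k] Metric_space.commute[OF M]
      by (simp add: rep_dist_def)
  qed (use qd rep in auto)
qed

theorem proposition38:
  shows "(\<bb> =o \<dd> \<longrightarrow> Delta_class (metrizable_class :: 'a topology set)) \<and>
    (\<dd> =o \<cc> \<longrightarrow> Delta_class (metrizable_class_card_le \<cc> :: 'a topology set)) \<and>
    (Model_Hypothesis \<longrightarrow> Delta_class (separable_metrizable_class :: 'a topology set))"
proof (intro conjI impI)
  assume "\<bb> =o \<dd>"
  then have "Delta_spaces X" if "\<And>n. metrizable_space (X n)" for X :: "nat \<Rightarrow> 'a topology"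
    by (intro Delta_spaces_if_resolvable[OF that])
      (rule resolvable_if_b_eq_d[OF _ rep_dist_commute])
  then show "Delta_class (metrizable_class :: 'a topology set)"
    by (simp add: Delta_class_def metrizable_class_def)
next
  assume dc: "\<dd> =o \<cc>"
  show "Delta_class (metrizable_class_card_le \<cc> :: 'a topology set)"
    unfolding Delta_class_def
  proof (intro allI impI)
    fix X :: "nat \<Rightarrow> 'a topology" assume "\<forall>n. X n \<in> metrizable_class_card_le \<cc>"
    then have X: "\<And>n. metrizable_space (X n)" "\<And>n. |topspace (X n)| \<le>o \<cc>"
      by (auto simp: metrizable_class_card_le_def)
    have "|nabla X \<times> (UNIV :: (nat \<Rightarrow> nat) set)| \<le>o \<dd>"
      by (rule ordLeq_ordIso_trans[OF card_nabla_times_le_continuum[OF X(2)] ordIso_symmetric[OF dc]])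
    then show "Delta_spaces X"
      by (intro Delta_spaces_if_resolvable[OF X(1)])
        (rule resolvable_if_card_le_d[OF _ rep_dist_commute rep_dist_self])
  qed
next
  assume MH: "Model_Hypothesis"
  have "Delta_spaces X" if "\<And>n. metrizable_space (X n)" "\<And>n. separable_space (X n)"
    for X :: "nat \<Rightarrow> 'a topology"
    by (intro Delta_spaces_if_resolvable[OF that(1)])
      (rule resolvable_nabla_if_MH[OF MH _ that(2)])
  then show "Delta_class (separable_metrizable_class :: 'a topology set)"
    by (simp add: Delta_class_def separable_metrizable_class_def)
qed

end
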